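(* Consider the following three assertions. (E) For every primitive sequence $\mathscr{A} \neq \{1\}$, $$\sum_{a \in \mathscr{A}} \frac{1}{a \log a} \leq \sum_{p \in \mathscr{P}} \frac{1}{p \log p}.$$ (F) For every primitive sequence $\mathscr{A} \neq \{1\}$, $$\sum_{a \in \mathscr{A}} \frac{1}{a \log a} \leq \sum_{p \in P(\mathscr{A})} \frac{1}{p \log p}.$$ (G) For every primitive sequence $\mathscr{A} \neq \{1\}$, $$\sum_{a \in \mathscr{A}} \frac{1}{a \log a} \leq \sum_{n=1}^{\mathrm{Card}\,\mathscr{A}} \frac{1}{p_n \log p_n}.$$ Then (F) is equivalent to (E), and (G) is equivalent to (E).
   Context: A (finite or infinite) sequence $\mathscr{A}$ of positive integers is called primitive if it is strictly increasing and no term of $\mathscr{A}$ divides any other term; it is identified with its set of terms. $\mathscr{P} = (p_n)_{n \geq 1}$ denotes the increasing sequence of all prime numbers ($p_1 = 2$, $p_2 = 3$, ...). For a sequence $\mathscr{A}$ of positive integers, $P(\mathscr{A}) := \{p \in \mathscr{P} : \exists a \in \mathscr{A},\ p \mid a\}$ is the set of prime divisors of the terms of $\mathscr{A}$, and $\mathrm{Card}\,\mathscr{A}$ is its cardinality; when $\mathscr{A}$ is infinite, the sum $\sum_{n=1}^{\mathrm{Card}\,\mathscr{A}}$ means $\sum_{n=1}^{+\infty}$. $\log$ is the natural logarithm. By a theorem of Erdős, $\sum_{a \in \mathscr{A}} \frac{1}{a \log a}$ converges for every primitive sequence $\mathscr{A} \neq \{1\}$. *)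

theory Defs
  imports "HOL-Analysis.Analysis" "HOL-Computational_Algebra.Primes" "HOL-Library.Infinite_Set"
begin

text \<open>
  A strictly increasing (finite or infinite) sequence of positive integers is identified with
  its set of terms.
\<close>

definition primitive_seq :: "nat set \<Rightarrow> bool" where
  "primitive_seq A \<longleftrightarrow> (\<forall>a\<in>A. 0 < a) \<and> (\<forall>a\<in>A. \<forall>b\<in>A. a \<noteq> b \<longrightarrow> \<not> a dvd b)"

definition prime_divisors :: "nat set \<Rightarrow> nat set" where
  "prime_divisors A = {p. prime p \<and> (\<exists>a\<in>A. p dvd a)}"

text \<open>
  The primes in increasing order, indexed from 1. The function \<^const>\<open>enumerate\<close> counts from 0,
  and \<open>nth_prime 0\<close> is a junk value that is never used.
\<close>

definition nth_prime :: "nat \<Rightarrow> nat" where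
  "nth_prime n = enumerate {p. prime p} (n - 1)"

text \<open>
  All sums have nonnegative terms and are taken in the extended nonnegative reals, where they
  always exist; this avoids the default value 0 that a divergent real-valued \<^const>\<open>infsum\<close>
  would take. By Erdos's theorem all the sums below are in fact finite. The junk value at
  \<open>a = 1\<close> plays no role, as \<open>{1}\<close> is the only primitive sequence containing 1.
\<close>

definition erdos_term :: "nat \<Rightarrow> ennreal" where
  "erdos_term a = ennreal (1 / (real a * ln (real a)))"

definition assertion_E :: bool where
  "assertion_E \<longleftrightarrow> (\<forall>A. primitive_seq A \<and> A \<noteq> {1} \<longrightarrow>
     (\<Sum>\<^sub>\<infinity>a\<in>A. erdos_term a) \<le> (\<Sum>\<^sub>\<infinity>p\<in>{p. prime p}. erdos_term p))"

definition assertion_F :: bool where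
  "assertion_F \<longleftrightarrow> (\<forall>A. primitive_seq A \<and> A \<noteq> {1} \<longrightarrow>
     (\<Sum>\<^sub>\<infinity>a\<in>A. erdos_term a) \<le> (\<Sum>\<^sub>\<infinity>p\<in>prime_divisors A. erdos_term p))"

definition assertion_G :: bool where
  "assertion_G \<longleftrightarrow> (\<forall>A. primitive_seq A \<and> A \<noteq> {1} \<longrightarrow>
     (\<Sum>\<^sub>\<infinity>a\<in>A. erdos_term a) \<le>
     (if finite A then \<Sum>n = 1..card A. erdos_term (nth_prime n)
      else \<Sum>\<^sub>\<infinity>n\<in>{1..}. erdos_term (nth_prime n)))"

end

theory Submission
  imports Defs
begin

text \<open>
  Write \<open>f a = 1 / (a log a)\<close> and let \<open>P(A)\<close> be the set of prime divisors of the terms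
  of \<open>A\<close>. Each of (F) and (G) bounds the sum over \<open>A\<close> by a sum over part of the primes, so each
  implies (E). For the converses:

  (E) implies (F). Adjoin to \<open>A\<close> every prime outside \<open>P(A)\<close>. The result is again primitive, and
  the union is disjoint, so (E) applied to it reads
  \<open>f(A) + f(primes - P(A)) \<le> f(P(A)) + f(primes - P(A))\<close>, where \<open>f(X)\<close> is the sum of \<open>f\<close> over \<open>X\<close>.
  The common summand may be cancelled because it is finite, and this is the one place where
  analytic input is needed: the sum of \<open>1 / (p log p)\<close> over the primes converges. By
  Chebyshev's argument a dyadic block \<open>(2^k, 2^(k+1)]\<close> contains at most \<open>2^(k+1) / k\<close> primes, so
  it contributes \<open>O(1/k^2)\<close>.

  (E) implies (G). For infinite \<open>A\<close> the two right-hand sides agree. For \<open>A\<close> with \<open>N\<close> elements,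
  use induction on \<open>N\<close>. If \<open>P(A)\<close> has fewer than \<open>N\<close> elements, then (F) suffices, since a set of
  fewer than \<open>N\<close> primes has a smaller \<open>f\<close>-sum than the first \<open>N\<close> primes. Otherwise the largest
  \<open>q\<close> in \<open>P(A)\<close> is at least the \<open>N\<close>-th prime, so a term \<open>a\<close> of \<open>A\<close> divisible by \<open>q\<close> satisfies
  \<open>f(a) \<le> f(p_N)\<close>, and the induction hypothesis handles \<open>A - {a}\<close>, which is still primitive.
\<close>

section \<open>Convergence of the sum over the primes\<close>

lemma prod_primes_dvd:
  assumes "finite Q" "\<And>p. p \<in> Q \<Longrightarrow> prime p" "\<And>p. p \<in> Q \<Longrightarrow> p dvd n"
  shows "\<Prod>Q dvd (n :: nat)"
  using assms
proof (induction Q rule: finite_induct)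
  case (insert p Q)
  have "coprime p (\<Prod>Q)"
    using insert by (intro prod_coprime_right primes_coprime) auto
  thus ?case
    using insert by (simp add: divides_mult)
qed simp

text \<open>
  Chebyshev's argument: with \<open>n = 2^k\<close>, every prime in \<open>(n, 2n]\<close> divides \<open>(2n)!\<close> but not \<open>n!\<close>,
  hence it divides the central binomial coefficient, which is at most \<open>4^n\<close>. The product of
  these primes is at least \<open>n\<close> to the power of their number; comparing exponents of 2 gives the bound.
\<close>

lemma card_primes_dyadic_block:
  "k * card {p. prime p \<and> 2 ^ k < p \<and> p \<le> (2::nat) ^ (k + 1)} \<le> 2 ^ (k + 1)"
proof -
  define n :: nat where "n = 2 ^ k"
  define B where "B = {p. prime p \<and> n < p \<and> p \<le> 2 * n}"
  have fin: "finite B"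
    by (rule finite_subset[of _ "{..2 * n}"]) (auto simp: B_def)
  have "p dvd (2 * n) choose n" if "p \<in> B" for p
  proof -
    have p: "prime p" "n < p" "p \<le> 2 * n"
      using that by (auto simp: B_def)
    have eq: "fact n * fact n * ((2 * n) choose n) = (fact (2 * n) :: nat)"
      using binomial_fact_lemma[of n "2 * n"] by simp
    have "p dvd fact n * fact n * ((2 * n) choose n)"
      unfolding eq using p by (simp add: prime_dvd_fact_iff)
    thus ?thesis
      using p by (simp add: prime_dvd_mult_iff prime_dvd_fact_iff)
  qed
  hence "\<Prod>B dvd (2 * n) choose n"
    using fin by (intro prod_primes_dvd) (auto simp: B_def)
  hence "\<Prod>B \<le> (2 * n) choose n"
    by (intro dvd_imp_le) auto
  moreover have "n ^ card B \<le> \<Prod>B"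
    using prod_mono[of B "\<lambda>_. n" "\<lambda>p. p"] by (auto simp: B_def)
  ultimately have "n ^ card B \<le> 2 ^ (2 * n)"
    using binomial_le_pow2[of "2 * n" n] by linarith
  hence "(2::nat) ^ (k * card B) \<le> 2 ^ (2 * n)"
    by (simp add: n_def power_mult)
  hence "k * card B \<le> 2 * n"
    by (subst (asm) power_increasing_iff) auto
  thus ?thesis
    by (simp add: B_def n_def)
qed

text \<open>
  For \<open>k \<ge> 1\<close> there are at most \<open>2^(k+1) / k\<close> terms, each at most \<open>1 / (2^k k log 2)\<close>, which
  gives the bound \<open>2 / (k^2 log 2)\<close>. Weakening \<open>1 / k^2\<close> to \<open>4 / (k+1)^2\<close> makes the bound
  meaningful at \<open>k = 0\<close> as well, where the block is \<open>{2}\<close>.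
\<close>

lemma sum_primes_dyadic_block:
  "(\<Sum>p | prime p \<and> 2 ^ k < p \<and> p \<le> (2::nat) ^ (k + 1). 1 / (real p * ln (real p)))
     \<le> 8 / ln 2 * (1 / (real k + 1)\<^sup>2)" (is "sum ?g ?B \<le> _")
proof (cases "k = 0")
  case True
  have "?B = {2}"
    using True two_is_prime_nat by (auto simp del: two_is_prime_nat)
  thus ?thesis
    using True by (simp add: field_simps)
next
  case False
  define c where "c = card ?B"
  have k: "k \<ge> 1"
    using False by simp
  have ln2: "ln 2 > (0::real)"
    by simp
  have "?g p \<le> 1 / (2 ^ k * (k * ln 2))" if "p \<in> ?B" for p
  proof -
    have p: "real p \<ge> 2 ^ k"
      using that by (metis (mono_tags, lifting) less_imp_le mem_Collect_eq of_nat_le_iff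
        of_nat_numeral of_nat_power)
    hence "ln (real p) \<ge> ln (2 ^ k)"
      by (intro ln_mono) (auto intro: less_le_trans[of _ "2 ^ k"])
    hence "ln (real p) \<ge> k * ln 2"
      by (simp add: ln_realpow)
    moreover have "real k * ln 2 > 0"
      using k by simp
    ultimately have "2 ^ k * (k * ln 2) \<le> real p * ln (real p)"
      using p by (intro mult_mono) auto
    thus ?thesis
      using \<open>real k * ln 2 > 0\<close> by (intro frac_le) auto
  qed
  hence "sum ?g ?B \<le> c * (1 / (2 ^ k * (k * ln 2)))"
    unfolding c_def by (rule sum_bounded_above)
  also have "\<dots> \<le> (2 ^ (k + 1) / k) * (1 / (2 ^ k * (k * ln 2)))"
  proof (rule mult_right_mono)
    have "real (k * c) \<le> real (2 ^ (k + 1))"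
      using card_primes_dyadic_block[of k] unfolding c_def of_nat_le_iff .
    thus "real c \<le> 2 ^ (k + 1) / k"
      using k by (simp add: field_simps)
  qed (use ln2 in auto)
  also have "\<dots> = 2 / ln 2 * (1 / (real k)\<^sup>2)"
    using k ln2 by (simp add: field_simps power2_eq_square)
  also have "\<dots> \<le> 2 / ln 2 * (4 / (real k + 1)\<^sup>2)"
  proof (rule mult_left_mono)
    have "(real k + 1)\<^sup>2 \<le> (2 * real k)\<^sup>2"
      using k by (intro power_mono) auto
    thus "1 / (real k)\<^sup>2 \<le> 4 / (real k + 1)\<^sup>2"
      using k by (simp add: divide_simps power_mult_distrib)
  qed (use ln2 in auto)
  finally show ?thesis
    by simp
qed

text \<open>
  Every finite set of primes is split along the dyadic blocks, so all its partial sums lie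
  below one convergent series.
\<close>

lemma infsum_erdos_term_primes_finite:
  "(\<Sum>\<^sub>\<infinity>p\<in>{p. prime p}. erdos_term p) < \<infinity>"
proof -
  define g where "g = (\<lambda>p. 1 / (real p * ln (real p)))"
  define c where "c = (\<lambda>k. 8 / ln 2 * (1 / (real k + 1)\<^sup>2))"
  have c_nonneg: "c k \<ge> 0" for k
    by (simp add: c_def)
  have "summable (\<lambda>k. 1 / (real k + 1)\<^sup>2)"
    using inverse_squares_sums by (simp add: sums_iff add.commute)
  hence summ: "summable c"
    unfolding c_def by (rule summable_mult)
  have "\<forall>p. \<exists>k. 2 \<le> p \<longrightarrow> (2::nat) ^ k < p \<and> p \<le> 2 ^ (k + 1)"
    using ex_power_ivl2[of 2] by blast
  \<comment> \<open>\<open>h p\<close> is the index of the dyadic block that contains \<open>p\<close>.\<close>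
  then obtain h where h: "2 \<le> p \<Longrightarrow> (2::nat) ^ h p < p \<and> p \<le> 2 ^ (h p + 1)" for p
    by metis
  have "sum erdos_term F \<le> ennreal (suminf c)" if F: "finite F" "F \<subseteq> {p. prime p}" for F
  proof -
    have g_nonneg: "g p \<ge> 0" if "prime p" for p
      using prime_ge_1_nat[OF that] by (simp add: g_def)
    have "sum g F = (\<Sum>k\<in>h ` F. sum g {p \<in> F. h p = k})"
      by (rule sum.image_gen[OF F(1)])
    also have "\<dots> \<le> (\<Sum>k\<in>h ` F. c k)"
    proof (rule sum_mono)
      fix k
      have fin: "finite {p. prime p \<and> 2 ^ k < p \<and> p \<le> (2::nat) ^ (k + 1)}"
        by (rule finite_subset[of _ "{..2 ^ (k + 1)}"]) auto
      have "sum g {p \<in> F. h p = k} \<le> sum g {p. prime p \<and> 2 ^ k < p \<and> p \<le> (2::nat) ^ (k + 1)}"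
        using F(2) h prime_ge_2_nat g_nonneg by (intro sum_mono2 fin) blast+
      also have "\<dots> \<le> c k"
        using sum_primes_dyadic_block[of k] by (simp add: g_def c_def)
      finally show "sum g {p \<in> F. h p = k} \<le> c k" .
    qed
    also have "\<dots> \<le> suminf c"
      using F(1) c_nonneg by (intro sum_le_suminf summ) auto
    finally have "ennreal (sum g F) \<le> ennreal (suminf c)"
      by (rule ennreal_leI)
    moreover have "sum erdos_term F = ennreal (sum g F)"
      using F(2) g_nonneg by (subst sum_ennreal[symmetric]) (auto simp: erdos_term_def g_def)
    ultimately show ?thesis
      by simp
  qed
  hence "(\<Sum>\<^sub>\<infinity>p\<in>{p. prime p}. erdos_term p) \<le> ennreal (suminf c)"
    by (intro infsum_le_finite_sums nonneg_summable_on_complete) auto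
  also have "\<dots> < \<infinity>"
    by simp
  finally show ?thesis .
qed

section \<open>From all primes to the prime divisors\<close>

lemma infsum_mono_set_ennreal:
  fixes f :: "'a \<Rightarrow> ennreal"
  assumes "A \<subseteq> B"
  shows "infsum f A \<le> infsum f B"
  using assms by (intro infsum_mono_neutral nonneg_summable_on_complete) auto

lemma primitive_seq_one_mem_iff:
  assumes "primitive_seq A"
  shows "1 \<in> A \<longleftrightarrow> A = {1}"
proof
  assume one: "1 \<in> A"
  have "a = 1" if "a \<in> A" for a
  proof (rule ccontr)
    assume "a \<noteq> 1"
    hence "\<not> 1 dvd a"
      using assms one that unfolding primitive_seq_def by metis
    thus False
      by simp
  qed
  with one show "A = {1}"
    by blast
qed blast

text \<open>
  A prime outside \<open>P(A)\<close> divides no term of \<open>A\<close>. Conversely, a term of \<open>A\<close> dividing such a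
  prime would be 1, or the prime itself, which would then lie in \<open>P(A)\<close>; the value 1 is where
  \<open>A \<noteq> {1}\<close> enters.
\<close>

lemma primitive_seq_add_nondivisors:
  assumes "primitive_seq A" "A \<noteq> {1}"
  shows "primitive_seq (A \<union> ({p. prime p} - prime_divisors A))"
proof -
  have one: "1 \<notin> A"
    using assms primitive_seq_one_mem_iff by blast
  have pos: "0 < a" if "a \<in> A" for a
    using assms(1) that by (simp add: primitive_seq_def)
  have AA: "\<not> a dvd b" if "a \<in> A" "b \<in> A" "a \<noteq> b" for a b
    using assms(1) that by (simp add: primitive_seq_def)
  have Ap: "\<not> a dvd p" if "a \<in> A" "prime p" "p \<notin> prime_divisors A" for a p
    using that one by (auto simp: prime_divisors_def prime_nat_iff)
  have pA: "\<not> p dvd a" if "a \<in> A" "prime p" "p \<notin> prime_divisors A" for a p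
    using that by (auto simp: prime_divisors_def)
  have pq: "\<not> p dvd q" if "prime p" "prime q" "p \<noteq> q" for p q :: nat
    using that primes_dvd_imp_eq by blast
  show ?thesis
    unfolding primitive_seq_def using pos AA Ap pA pq prime_gt_0_nat by blast
qed

text \<open>
  (E) for the enlarged sequence, after cancelling the sum over the adjoined primes.
\<close>

lemma assertion_E_imp_F:
  assumes assertion_E
  shows assertion_F
  unfolding assertion_F_def
proof (intro allI impI)
  fix A assume A: "primitive_seq A \<and> A \<noteq> {1}"
  define P where "P = {p::nat. prime p}"
  define D where "D = prime_divisors A"
  have D: "D \<subseteq> P"
    by (auto simp: D_def P_def prime_divisors_def)
  have summ: "erdos_term summable_on X" for X
    by (rule nonneg_summable_on_complete) simp
  have "1 \<notin> A"
    using A primitive_seq_one_mem_iff by blast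
  hence "A \<union> (P - D) \<noteq> {1}"
    by (auto simp: P_def)
  moreover have "primitive_seq (A \<union> (P - D))"
    using primitive_seq_add_nondivisors A by (simp add: P_def D_def)
  ultimately have "infsum erdos_term (A \<union> (P - D)) \<le> infsum erdos_term P"
    using assms unfolding assertion_E_def P_def by blast
  moreover have "A \<inter> (P - D) = {}"
    unfolding P_def D_def prime_divisors_def using dvd_refl by blast
  hence "infsum erdos_term (A \<union> (P - D)) = infsum erdos_term (P - D) + infsum erdos_term A"
    by (simp add: infsum_Un_disjoint summ add.commute)
  moreover have "infsum erdos_term P = infsum erdos_term (P - D) + infsum erdos_term D"
    using infsum_Un_disjoint[of erdos_term "P - D" D] summ D
    by (simp add: Int_commute Un_absorb2)
  moreover have "infsum erdos_term (P - D) < \<infinity>"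
    using infsum_mono_set_ennreal[of "P - D" P erdos_term] infsum_erdos_term_primes_finite
    by (auto simp: P_def)
  ultimately show "infsum erdos_term A \<le> infsum erdos_term (prime_divisors A)"
    by (auto simp: ennreal_add_left_cancel_le D_def)
qed

lemma assertion_F_imp_E:
  assumes assertion_F
  shows assertion_E
  unfolding assertion_E_def
proof (intro allI impI)
  fix A assume "primitive_seq A \<and> A \<noteq> {1}"
  hence "infsum erdos_term A \<le> infsum erdos_term (prime_divisors A)"
    using assms by (simp add: assertion_F_def)
  also have "\<dots> \<le> infsum erdos_term {p. prime p}"
    by (rule infsum_mono_set_ennreal) (auto simp: prime_divisors_def)
  finally show "infsum erdos_term A \<le> infsum erdos_term {p. prime p}" .
qed

section \<open>From the prime divisors to the first primes\<close>

lemma erdos_term_antimono: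
  assumes "2 \<le> a" "a \<le> b"
  shows "erdos_term b \<le> erdos_term a"
  unfolding erdos_term_def using assms
  by (intro ennreal_leI divide_left_mono mult_mono mult_pos_pos) auto

lemma prime_nth_prime: "prime (nth_prime n)"
  using enumerate_in_set[OF primes_infinite] by (simp add: nth_prime_def)

lemma bij_betw_nth_prime: "bij_betw nth_prime {1..} {p. prime p}"
proof -
  have "bij_betw (\<lambda>n. n - 1) {1..} (UNIV :: nat set)"
    by (rule bij_betwI[where g = Suc]) auto
  from bij_betw_trans[OF this bij_enumerate[OF primes_infinite]]
  show ?thesis
    by (simp add: nth_prime_def[abs_def] o_def)
qed

text \<open>
  If the maximum of \<open>Q\<close> has index \<open>m\<close> in \<open>S\<close>, then \<open>Q\<close> lies among the \<open>m + 1\<close> elements of index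
  at most \<open>m\<close>.
\<close>

lemma enumerate_card_le_Max:
  fixes S :: "nat set"
  assumes "infinite S" "finite Q" "Q \<subseteq> S" "Q \<noteq> {}"
  shows "enumerate S (card Q - 1) \<le> Max Q"
proof -
  obtain m where m: "Max Q = enumerate S m"
    using assms Max_in[of Q] enumerate_Ex by (metis subsetD)
  have "Q \<subseteq> enumerate S ` {..m}"
  proof
    fix q assume q: "q \<in> Q"
    then obtain i where i: "q = enumerate S i"
      using assms enumerate_Ex by (metis subsetD)
    have "q \<le> enumerate S m"
      using q assms(2) m by (metis Max_ge)
    thus "q \<in> enumerate S ` {..m}"
      using i assms(1) by simp
  qed
  hence "card Q \<le> m + 1"
    using surj_card_le[of "{..m}" Q "enumerate S"] by simp
  thus ?thesis
    using m assms(1) by simp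
qed

lemma nth_prime_le_Max:
  assumes "finite Q" "Q \<subseteq> {p. prime p}" "0 < n" "n \<le> card Q"
  shows "nth_prime n \<le> Max Q"
proof -
  have "nth_prime n \<le> enumerate {p. prime p} (card Q - 1)"
    unfolding nth_prime_def using assms primes_infinite by simp
  also have "\<dots> \<le> Max Q"
    using assms by (intro enumerate_card_le_Max primes_infinite) auto
  finally show ?thesis .
qed

text \<open>
  Remove the largest prime of \<open>Q\<close>: it is at least the prime with index \<open>card Q\<close>, and
  \<^const>\<open>erdos_term\<close> is decreasing.
\<close>

lemma sum_primes_le_sum_first_primes:
  assumes "finite Q" "Q \<subseteq> {p. prime p}"
  shows "sum erdos_term Q \<le> (\<Sum>n = 1..card Q. erdos_term (nth_prime n))"
  using assms
proof (induction "card Q" arbitrary: Q)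
  case 0
  thus ?case by simp
next
  case (Suc N)
  define q where "q = Max Q"
  have q: "q \<in> Q"
    using Suc.hyps(2) Suc.prems(1) unfolding q_def by (intro Max_in) auto
  have "nth_prime (Suc N) \<le> q"
    unfolding q_def using Suc.hyps(2) Suc.prems by (intro nth_prime_le_Max) auto
  hence "erdos_term q \<le> erdos_term (nth_prime (Suc N))"
    using prime_nth_prime prime_ge_2_nat by (intro erdos_term_antimono) blast+
  moreover have "sum erdos_term (Q - {q}) \<le> (\<Sum>n = 1..N. erdos_term (nth_prime n))"
  proof -
    have N: "N = card (Q - {q})"
      using Suc.hyps(2) Suc.prems(1) q by simp
    show ?thesis
      using Suc.hyps(1)[OF N] Suc.prems unfolding N[symmetric] by blast
  qed
  ultimately show ?case
    using Suc.prems(1) q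
    by (simp add: sum.remove[of Q q] Suc.hyps(2)[symmetric] add.commute add_mono)
qed

lemma finite_prime_divisors:
  assumes "finite A" "\<forall>a\<in>A. 0 < a"
  shows "finite (prime_divisors A)"
proof -
  have "prime_divisors A \<subseteq> (\<Union>a\<in>A. {..a})"
    using assms(2) by (auto simp: prime_divisors_def intro: dvd_imp_le)
  thus ?thesis
    using assms(1) by (auto intro: finite_subset)
qed

text \<open>
  The induction compares \<open>card A\<close> with the number of primes in \<open>P(A)\<close>. Few primes: (F) already
  gives the bound. Many primes: one of them is so large that a term it divides can be charged to
  the last prime on the right-hand side.
\<close>

lemma assertion_F_imp_G_finite:
  assumes assertion_F
  assumes "finite A" "primitive_seq A" "A \<noteq> {1}"
  shows "sum erdos_term A \<le> (\<Sum>n = 1..card A. erdos_term (nth_prime n))"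
  using assms(2-4)
proof (induction "card A" arbitrary: A)
  case 0
  thus ?case by simp
next
  case (Suc N)
  note card = \<open>Suc N = card A\<close>
  define Q where "Q = prime_divisors A"
  have pos: "\<forall>a\<in>A. 0 < a"
    using Suc.prems(2) by (simp add: primitive_seq_def)
  have Q: "finite Q" "Q \<subseteq> {p. prime p}"
    using finite_prime_divisors[OF Suc.prems(1) pos]
    by (auto simp: Q_def prime_divisors_def)
  show ?case
  proof (cases "card Q \<le> N")
    case True
    have "sum erdos_term A \<le> sum erdos_term Q"
      using assms(1) Suc.prems Q(1) by (auto simp: assertion_F_def Q_def)
    also have "\<dots> \<le> (\<Sum>n = 1..card Q. erdos_term (nth_prime n))"
      using Q by (rule sum_primes_le_sum_first_primes)
    also have "\<dots> \<le> (\<Sum>n = 1..card A. erdos_term (nth_prime n))"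
      using True card by (intro sum_mono2) auto
    finally show ?thesis .
  next
    case False
    define q where "q = Max Q"
    have "q \<in> Q"
      unfolding q_def using False Q(1) by (intro Max_in) auto
    then obtain a where a: "a \<in> A" "q dvd a"
      by (auto simp: Q_def prime_divisors_def)
    have "nth_prime (Suc N) \<le> q"
      unfolding q_def using False Q by (intro nth_prime_le_Max) auto
    also have "q \<le> a"
      using a pos by (intro dvd_imp_le) auto
    finally have "erdos_term a \<le> erdos_term (nth_prime (Suc N))"
      using prime_nth_prime prime_ge_2_nat by (intro erdos_term_antimono) blast+
    moreover have "sum erdos_term (A - {a}) \<le> (\<Sum>n = 1..N. erdos_term (nth_prime n))"
    proof -
      have N: "N = card (A - {a})"
        using card Suc.prems(1) a(1) by simp
      have "1 \<notin> A"
        using Suc.prems primitive_seq_one_mem_iff by blast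
      hence "A - {a} \<noteq> {1}"
        by blast
      moreover have "primitive_seq (A - {a})"
        using Suc.prems(2) by (simp add: primitive_seq_def)
      ultimately show ?thesis
        using Suc.hyps(1)[OF N] Suc.prems(1) N by simp
    qed
    ultimately show ?thesis
      using Suc.prems(1) a(1)
      by (simp add: sum.remove[of A a] card[symmetric] add.commute add_mono)
  qed
qed

lemma infsum_erdos_term_nth_prime:
  "(\<Sum>\<^sub>\<infinity>n\<in>{1..}. erdos_term (nth_prime n)) = (\<Sum>\<^sub>\<infinity>p\<in>{p. prime p}. erdos_term p)"
  by (rule infsum_reindex_bij_betw[OF bij_betw_nth_prime])

lemma assertion_E_imp_G:
  assumes assertion_E
  shows assertion_G
  using assms assertion_F_imp_G_finite[OF assertion_E_imp_F[OF assms]]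
  unfolding assertion_G_def assertion_E_def infsum_erdos_term_nth_prime by simp

lemma assertion_G_imp_E:
  assumes assertion_G
  shows assertion_E
  unfolding assertion_E_def
proof (intro allI impI)
  fix A assume A: "primitive_seq A \<and> A \<noteq> {1}"
  have "(\<Sum>n = 1..card A. erdos_term (nth_prime n))
      \<le> (\<Sum>\<^sub>\<infinity>n\<in>{1..}. erdos_term (nth_prime n))"
    using infsum_mono_set_ennreal[of "{1..card A}" "{1..}" "\<lambda>n. erdos_term (nth_prime n)"]
    by auto
  hence "(if finite A then \<Sum>n = 1..card A. erdos_term (nth_prime n)
      else \<Sum>\<^sub>\<infinity>n\<in>{1..}. erdos_term (nth_prime n)) \<le> infsum erdos_term {p. prime p}"
    unfolding infsum_erdos_term_nth_prime by simp
  moreover have "infsum erdos_term A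
      \<le> (if finite A then \<Sum>n = 1..card A. erdos_term (nth_prime n)
         else \<Sum>\<^sub>\<infinity>n\<in>{1..}. erdos_term (nth_prime n))"
    using assms A unfolding assertion_G_def by blast
  ultimately show "infsum erdos_term A \<le> infsum erdos_term {p. prime p}"
    by (rule order_trans[rotated])
qed

theorem proposition2p3:
  "(assertion_F \<longleftrightarrow> assertion_E) \<and> (assertion_G \<longleftrightarrow> assertion_E)"
  using assertion_E_imp_F assertion_F_imp_E assertion_E_imp_G assertion_G_imp_E by blast

end
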